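(* Let $\alpha,\beta,\sigma$, $(s_n)_{n\ge0}$, and the operators $\partial^+,\partial^-$, and $$U=\partial^++\beta\partial^+\partial^-+\frac\sigma\alpha,\qquad V=\alpha\partial^-+1$$ in $\mathcal P(\mathbb C)$ be as in the context. The operators $U$ and $V$ acting in $\mathcal P(\mathbb C)$ can be (uniquely) extended to continuous linear operators acting in $\mathcal E^1_{\mathrm{min}}(\mathbb C)$; preserve the notations $U$ and $V$ for these extensions, and let $Z$ denote the continuous linear operator in $\mathcal E^1_{\mathrm{min}}(\mathbb C)$ of multiplication by the variable $z$. If $\alpha\ge\beta>0$, then $Z=UV$ and $U=Z(1-\alpha D_{\beta-\alpha})$. If $\Re(\alpha)\ge0$, $\Im(\alpha)>0$ and $\beta=\overline\alpha$, then $Z+\frac\sigma\alpha=UV$ and $U=(Z+\frac\sigma\alpha)(1-\alpha D_{\beta-\alpha})$. In either case, the operator $1-\alpha D_{\beta-\alpha}$ is a self-homeomorphism of $\mathcal E^1_{\mathrm{min}}(\mathbb C)$ and $V=(1-\alpha D_{\beta-\alpha})^{-1}$.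
   Context: $\mathcal P(\mathbb C)$ is the space of complex polynomials. For $h\in\mathbb C\setminus\{0\}$, $(D_hf)(z)=h^{-1}(f(z+h)-f(z))$; $D_0$ denotes the differentiation $D=d/dz$. Parameters: $\sigma>0$, and $\alpha,\beta\in\mathbb C$ satisfy either $\alpha\ge\beta>0$ (then $l=\sigma/\alpha$) or $\Re(\alpha)\ge0$, $\Im(\alpha)>0$, $\beta=\overline\alpha$ (then $l=0$). Put $\lambda=\alpha+\beta$, $\eta=\alpha\beta$. $(s_n)_{n\ge0}$ is the monic polynomial sequence with $s_0=1$ and $zs_n(z)=s_{n+1}(z)+(\lambda n+l)s_n(z)+(\sigma n+\eta n(n-1))s_{n-1}(z)$. The linear operators $\partial^+,\partial^-$ in $\mathcal P(\mathbb C)$ are given by $\partial^+s_n=s_{n+1}$, $\partial^-s_n=ns_{n-1}$. $\mathcal E^1_{\mathrm{min}}(\mathbb C)$ is the space of entire functions $\varphi$ with $\|\varphi\|_t=\sup_{z\in\mathbb C}|\varphi(z)|e^{-t|z|}<\infty$ for all $t>0$, with the Fréchet topology defined by the norms $\|\cdot\|_t$, $t>0$. *)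

theory Defs
  imports "HOL-Complex_Analysis.Complex_Analysis" "HOL-Computational_Algebra.Polynomial"
begin

definition real_case :: "complex \<Rightarrow> complex \<Rightarrow> bool" where
  "real_case \<alpha> \<beta> \<longleftrightarrow> \<alpha> \<in> \<real> \<and> \<beta> \<in> \<real> \<and> Re \<alpha> \<ge> Re \<beta> \<and> Re \<beta> > 0"

definition conj_case :: "complex \<Rightarrow> complex \<Rightarrow> bool" where
  "conj_case \<alpha> \<beta> \<longleftrightarrow> Re \<alpha> \<ge> 0 \<and> Im \<alpha> > 0 \<and> \<beta> = cnj \<alpha>"

definition shift_par :: "complex \<Rightarrow> complex \<Rightarrow> real \<Rightarrow> complex" where
  "shift_par \<alpha> \<beta> \<sigma> = (if real_case \<alpha> \<beta> then of_real \<sigma> / \<alpha> else 0)"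

text \<open>For \<open>n = 0\<close> the term \<open>s (n - 1)\<close> (truncated subtraction) is multiplied by zero.\<close>

definition monic_recurrence_seq ::
    "complex \<Rightarrow> complex \<Rightarrow> real \<Rightarrow> (nat \<Rightarrow> complex poly) \<Rightarrow> bool" where
  "monic_recurrence_seq \<alpha> \<beta> \<sigma> s \<longleftrightarrow>
     (\<forall>n. degree (s n) = n \<and> lead_coeff (s n) = 1) \<and> s 0 = 1 \<and>
     (\<forall>n. [:0, 1:] * s n =
        s (Suc n)
        + smult ((\<alpha> + \<beta>) * of_nat n + shift_par \<alpha> \<beta> \<sigma>) (s n)
        + smult (of_real \<sigma> * of_nat n + \<alpha> * \<beta> * of_nat n * (of_nat n - 1)) (s (n - 1)))"

definition is_raising_op :: "(nat \<Rightarrow> complex poly) \<Rightarrow> (complex poly \<Rightarrow> complex poly) \<Rightarrow> bool" where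
  "is_raising_op s P \<longleftrightarrow> Vector_Spaces.linear smult smult P \<and> (\<forall>n. P (s n) = s (Suc n))"

definition is_lowering_op :: "(nat \<Rightarrow> complex poly) \<Rightarrow> (complex poly \<Rightarrow> complex poly) \<Rightarrow> bool" where
  "is_lowering_op s M \<longleftrightarrow> Vector_Spaces.linear smult smult M \<and>
     (\<forall>n. M (s n) = smult (of_nat n) (s (n - 1)))"

definition U_poly :: "complex \<Rightarrow> complex \<Rightarrow> real \<Rightarrow> (complex poly \<Rightarrow> complex poly) \<Rightarrow>
    (complex poly \<Rightarrow> complex poly) \<Rightarrow> complex poly \<Rightarrow> complex poly" where
  "U_poly \<alpha> \<beta> \<sigma> P M p = P p + smult \<beta> (P (M p)) + smult (of_real \<sigma> / \<alpha>) p"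

definition V_poly :: "complex \<Rightarrow> (complex poly \<Rightarrow> complex poly) \<Rightarrow> complex poly \<Rightarrow> complex poly" where
  "V_poly \<alpha> M p = smult \<alpha> (M p) + p"

text \<open>Operators on \<open>Emin\<close> are total HOL functions, of which only the values on \<open>Emin\<close> matter.\<close>

definition Emin :: "(complex \<Rightarrow> complex) set" where
  "Emin = {\<phi>. \<phi> holomorphic_on UNIV \<and>
     (\<forall>t>0. bdd_above (range (\<lambda>z. norm (\<phi> z) * exp (- t * norm z))))}"

definition exp_norm :: "real \<Rightarrow> (complex \<Rightarrow> complex) \<Rightarrow> real" where
  "exp_norm t \<phi> = (SUP z. norm (\<phi> z) * exp (- t * norm z))"

text \<open>The coarsest topology for which all open balls of the norms are open.\<close>

definition Emin_topology :: "(complex \<Rightarrow> complex) topology" where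
  "Emin_topology = topology_generated_by
     {{\<psi> \<in> Emin. exp_norm t (\<lambda>z. \<psi> z - \<phi> z) < \<epsilon>} | t \<phi> \<epsilon>. t > 0 \<and> \<epsilon> > 0 \<and> \<phi> \<in> Emin}"

lemma topspace_Emin_topology: "topspace Emin_topology = Emin"
proof
  show "topspace Emin_topology \<subseteq> Emin"
    unfolding Emin_topology_def topology_generated_by_topspace by (rule Union_least) auto
next
  show "Emin \<subseteq> topspace Emin_topology"
  proof
    fix \<phi> assume \<phi>: "\<phi> \<in> Emin"
    let ?B = "{\<psi> \<in> Emin. exp_norm 1 (\<lambda>z. \<psi> z - \<phi> z) < 1}"
    have "\<phi> \<in> ?B" using \<phi> by (simp add: exp_norm_def)
    moreover have "?B \<in> {{\<psi> \<in> Emin. exp_norm t (\<lambda>z. \<psi> z - \<phi> z) < \<epsilon>} | t \<phi> \<epsilon>.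
        t > 0 \<and> \<epsilon> > 0 \<and> \<phi> \<in> Emin}"
      by (rule CollectI, rule exI[of _ 1], rule exI[of _ \<phi>], rule exI[of _ 1]) (use \<phi> in simp)
    ultimately show "\<phi> \<in> topspace Emin_topology"
      unfolding Emin_topology_def topology_generated_by_topspace by (rule UnionI[rotated])
  qed
qed

definition continuous_linear_op ::
    "((complex \<Rightarrow> complex) \<Rightarrow> complex \<Rightarrow> complex) \<Rightarrow> bool" where
  "continuous_linear_op T \<longleftrightarrow> continuous_map Emin_topology Emin_topology T \<and>
     (\<forall>\<phi>\<in>Emin. \<forall>\<psi>\<in>Emin. T (\<lambda>z. \<phi> z + \<psi> z) = (\<lambda>z. T \<phi> z + T \<psi> z)) \<and>
     (\<forall>c. \<forall>\<phi>\<in>Emin. T (\<lambda>z. c * \<phi> z) = (\<lambda>z. c * T \<phi> z))"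

definition continuous_linear_extension ::
    "(complex poly \<Rightarrow> complex poly) \<Rightarrow> ((complex \<Rightarrow> complex) \<Rightarrow> complex \<Rightarrow> complex) \<Rightarrow> bool" where
  "continuous_linear_extension A T \<longleftrightarrow>
     continuous_linear_op T \<and> (\<forall>p. T (poly p) = poly (A p))"

definition diff_op :: "complex \<Rightarrow> (complex \<Rightarrow> complex) \<Rightarrow> complex \<Rightarrow> complex" where
  "diff_op h \<phi> = (if h = 0 then deriv \<phi> else (\<lambda>z. inverse h * (\<phi> (z + h) - \<phi> z)))"

definition one_minus_diff_op :: "complex \<Rightarrow> complex \<Rightarrow> (complex \<Rightarrow> complex) \<Rightarrow> complex \<Rightarrow> complex" where
  "one_minus_diff_op \<alpha> \<beta> \<phi> = (\<lambda>z. \<phi> z - \<alpha> * diff_op (\<beta> - \<alpha>) \<phi> z)"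

definition mult_var_op :: "(complex \<Rightarrow> complex) \<Rightarrow> complex \<Rightarrow> complex" where
  "mult_var_op \<phi> = (\<lambda>z. z * \<phi> z)"

end

theory Submission
  imports Defs
begin

text \<open>
  Cauchy's estimate with radius \<open>1 / t\<close> gives \<open>\<parallel>D f\<parallel>\<^sub>t \<le> e t \<parallel>f\<parallel>\<^sub>t\<close>, hence
  \<open>\<parallel>D\<^sub>h f\<parallel>\<^sub>t \<le> e t exp (t |h|) \<parallel>f\<parallel>\<^sub>t\<close>. So \<open>\<alpha> D\<^sub>h\<close> is a contraction for all small \<open>t\<close>,
  and \<open>1 - \<alpha> D\<^sub>h\<close> is inverted by a Neumann series; small \<open>t\<close> suffice, because the norms
  decrease in \<open>t\<close>. On polynomials, with \<open>h = \<beta> - \<alpha>\<close>, \<open>V = 1 + \<alpha> \<partial>\<^sup>-\<close> and \<open>V' = 1 + \<beta> \<partial>\<^sup>-\<close>,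
  the recurrence yields \<open>[\<partial>\<^sup>-, Z] = V V'\<close>, so that \<open>R = D\<^sub>h V - \<partial>\<^sup>-\<close> satisfies
  \<open>R Z = (Z + h) R + \<alpha> R V'\<close>. By induction \<open>R\<close> kills all \<open>s\<^sub>n\<close>, which means
  \<open>(1 - \<alpha> D\<^sub>h) V = 1\<close>. Evaluating on \<open>s\<^sub>n\<close> shows \<open>U V = Z + \<sigma> / \<alpha> - l\<close>, and therefore
  \<open>U = (Z + \<sigma> / \<alpha> - l) (1 - \<alpha> D\<^sub>h)\<close>. Taylor polynomials are dense, whence uniqueness.
\<close>

section \<open>The norms on \<open>Emin\<close>\<close>

lemma Emin_holomorphic: "f \<in> Emin \<Longrightarrow> f holomorphic_on A"
  by (auto simp: Emin_def intro: holomorphic_on_subset)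

lemma norm_le_exp_norm:
  assumes "f \<in> Emin" "t > 0"
  shows "norm (f z) \<le> exp_norm t f * exp (t * norm z)"
proof -
  have "norm (f z) * exp (- t * norm z) \<le> exp_norm t f"
    unfolding exp_norm_def using assms by (intro cSUP_upper) (auto simp: Emin_def)
  then show ?thesis by (simp add: exp_minus field_simps)
qed

lemma exp_norm_le:
  assumes "\<And>z. norm (f z) \<le> C * exp (t * norm z)"
  shows "exp_norm t f \<le> C"
  unfolding exp_norm_def
proof (rule cSUP_least)
  show "norm (f z) * exp (- t * norm z) \<le> C" for z
    using assms[of z] by (simp add: exp_minus field_simps)
qed simp

lemma exp_norm_nonneg: "f \<in> Emin \<Longrightarrow> t > 0 \<Longrightarrow> exp_norm t f \<ge> 0"
  using norm_le_exp_norm[of f t 0] order_trans[OF norm_ge_zero[of "f 0"]] by simp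

text \<open>The bound \<open>C t\<close> may depend on \<open>t\<close>. The second premise has the
  shape in which later estimates are proved, so one pointwise estimate gives both membership here
  and a norm bound through \<open>exp_norm_le\<close>.\<close>

lemma EminI:
  assumes "f holomorphic_on UNIV"
    and "\<And>t z. t > 0 \<Longrightarrow> norm (f z) \<le> C t * exp (t * norm z)"
  shows "f \<in> Emin"
proof -
  have "norm (f z) * exp (- t * norm z) \<le> C t" if "t > 0" for t z
    using assms(2)[OF that, of z] by (simp add: exp_minus field_simps)
  then have "bdd_above (range (\<lambda>z. norm (f z) * exp (- t * norm z)))" if "t > 0" for t
    using that by (intro bdd_aboveI) auto
  with assms(1) show ?thesis by (simp add: Emin_def)
qed

lemma norm_add_le_exp_norm:
  assumes "f \<in> Emin" "g \<in> Emin" "t > 0"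
  shows "norm (f z + g z) \<le> (exp_norm t f + exp_norm t g) * exp (t * norm z)"
  using norm_triangle_ineq[of "f z" "g z"] norm_le_exp_norm[OF assms(1,3), of z]
    norm_le_exp_norm[OF assms(2,3), of z] by (simp add: distrib_right)

lemma Emin_add:
  assumes "f \<in> Emin" "g \<in> Emin" shows "(\<lambda>z. f z + g z) \<in> Emin"
  by (rule EminI[OF _ norm_add_le_exp_norm[OF assms]])
    (intro holomorphic_intros Emin_holomorphic assms)

lemma exp_norm_triangle:
  assumes "f \<in> Emin" "g \<in> Emin" "t > 0"
  shows "exp_norm t (\<lambda>z. f z + g z) \<le> exp_norm t f + exp_norm t g"
  by (intro exp_norm_le norm_add_le_exp_norm assms)

lemma norm_cmult_le_exp_norm:
  assumes "f \<in> Emin" "t > 0"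
  shows "norm (c * f z) \<le> norm c * exp_norm t f * exp (t * norm z)"
  using mult_left_mono[OF norm_le_exp_norm[OF assms, of z], of "norm c"]
  by (simp add: norm_mult mult.assoc)

lemma Emin_cmult:
  assumes "f \<in> Emin" shows "(\<lambda>z. c * f z) \<in> Emin"
  by (rule EminI[OF _ norm_cmult_le_exp_norm[OF assms]])
    (intro holomorphic_intros Emin_holomorphic assms)

lemma exp_norm_cmult_le:
  "f \<in> Emin \<Longrightarrow> t > 0 \<Longrightarrow> exp_norm t (\<lambda>z. c * f z) \<le> norm c * exp_norm t f"
  by (intro exp_norm_le norm_cmult_le_exp_norm)

lemma Emin_diff:
  assumes "f \<in> Emin" "g \<in> Emin" shows "(\<lambda>z. f z - g z) \<in> Emin"
  using Emin_add[OF assms(1) Emin_cmult[OF assms(2), of "-1"]] by simp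

lemma Emin_const: "(\<lambda>z. c) \<in> Emin"
proof (rule EminI)
  fix t :: real assume "t > 0"
  then show "norm c \<le> norm c * exp (t * norm z)" for z :: complex
    by (simp add: mult_le_cancel_left1)
qed simp

text \<open>A larger \<open>t\<close> damps more strongly. Finitely many norms are thus dominated by
  the one of smallest index, and estimates for small \<open>t\<close> carry over to larger
  ones.\<close>

lemma exp_norm_antimono:
  assumes "f \<in> Emin" "0 < t" "t \<le> t'"
  shows "exp_norm t' f \<le> exp_norm t f"
proof (rule exp_norm_le)
  fix z
  have "norm (f z) \<le> exp_norm t f * exp (t * norm z)" by (rule norm_le_exp_norm) fact+
  also have "\<dots> \<le> exp_norm t f * exp (t' * norm z)"
    using assms by (intro mult_left_mono exp_norm_nonneg) (auto intro: mult_right_mono)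
  finally show "norm (f z) \<le> exp_norm t f * exp (t' * norm z)" .
qed

text \<open>Each \<open>exp_norm t\<close> by itself separates points. Hence Hausdorffness and the
  identities for the Neumann series can be checked at a single index.\<close>

lemma Emin_eq_zero:
  assumes "f \<in> Emin" "t > 0" "exp_norm t f \<le> 0" shows "f z = 0"
  using norm_le_exp_norm[OF assms(1,2), of z] assms(3)
  by (smt (verit) exp_gt_zero mult_nonpos_nonneg norm_le_zero_iff)

section \<open>Cauchy estimates for derivatives and difference quotients\<close>

lemma norm_deriv_le_exp_norm:
  assumes "f \<in> Emin" "t > 0"
  shows "norm (deriv f z) \<le> exp 1 * t * exp_norm t f * exp (t * norm z)"
proof -
  \<comment> \<open>The radius \<open>1 / t\<close> minimises \<open>exp (t * r) / r\<close> over
    \<open>r > 0\<close>. The resulting constant \<open>exp 1 * t\<close> tends to 0 with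
    \<open>t\<close>, which later makes the difference operators contractions.\<close>
  have "norm ((deriv ^^ 1) f z) \<le> fact 1 * (exp_norm t f * exp (t * (norm z + 1 / t))) / (1 / t) ^ 1"
  proof (rule Cauchy_inequality)
    show "f holomorphic_on ball z (1 / t)" by (rule Emin_holomorphic) fact
    show "continuous_on (cball z (1 / t)) f"
      by (intro holomorphic_on_imp_continuous_on Emin_holomorphic) fact
    show "0 < 1 / t" using assms by simp
    fix x assume x: "norm (z - x) = 1 / t"
    have "norm x \<le> norm z + 1 / t"
      using x norm_triangle_ineq3[of z x] by linarith
    then show "norm (f x) \<le> exp_norm t f * exp (t * (norm z + 1 / t))"
      using assms by (intro order_trans[OF norm_le_exp_norm[OF assms]] mult_left_mono exp_norm_nonneg)
        auto
  qed
  also have "t * (norm z + 1 / t) = 1 + t * norm z" using assms by (simp add: field_simps)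
  finally show ?thesis by (simp add: exp_add ac_simps)
qed

lemma Emin_deriv:
  assumes "f \<in> Emin" shows "deriv f \<in> Emin"
  by (rule EminI[OF _ norm_deriv_le_exp_norm[OF assms]])
    (intro holomorphic_deriv Emin_holomorphic assms open_UNIV)

lemma Emin_higher_deriv: "f \<in> Emin \<Longrightarrow> (deriv ^^ n) f \<in> Emin"
  by (induction n) (auto intro: Emin_deriv)

lemma exp_norm_higher_deriv_le:
  assumes "f \<in> Emin" "t > 0"
  shows "exp_norm t ((deriv ^^ n) f) \<le> (exp 1 * t) ^ n * exp_norm t f"
proof (induction n)
  case (Suc n)
  have "exp_norm t ((deriv ^^ Suc n) f) \<le> exp 1 * t * exp_norm t ((deriv ^^ n) f)"
    using norm_deriv_le_exp_norm[OF Emin_higher_deriv[OF assms(1)] assms(2)]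
    by (intro exp_norm_le) simp
  also have "\<dots> \<le> exp 1 * t * ((exp 1 * t) ^ n * exp_norm t f)"
    using assms by (intro mult_left_mono Suc.IH) auto
  finally show ?case by (simp add: ac_simps)
qed simp

lemma norm_diff_op_le_exp_norm:
  assumes "f \<in> Emin" "t > 0"
  shows "norm (diff_op h f z)
    \<le> exp 1 * t * exp (t * norm h) * exp_norm t f * exp (t * norm z)"
proof (cases "h = 0")
  case True
  then show ?thesis using norm_deriv_le_exp_norm[OF assms] by (simp add: diff_op_def)
next
  case False
  let ?B = "exp 1 * t * exp (t * norm h) * exp_norm t f * exp (t * norm z)"
  \<comment> \<open>Mean value inequality on \<open>cball z (norm h)\<close>, a convex set
    containing \<open>z\<close> and \<open>z + h\<close>. Its points have modulus at most
    \<open>norm z + norm h\<close>, whence the factor \<open>exp (t * norm h)\<close>.\<close>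
  have "norm (f (z + h) - f z) \<le> ?B * norm (z + h - z)"
  proof (rule field_differentiable_bound[of "cball z (norm h)" f "deriv f"])
    fix x assume x: "x \<in> cball z (norm h)"
    show "(f has_field_derivative deriv f x) (at x within cball z (norm h))"
      by (rule holomorphic_derivI[OF Emin_holomorphic[OF assms(1)] open_UNIV UNIV_I])
    have "norm x \<le> norm z + norm h"
      using x norm_triangle_ineq3[of z x] by (auto simp: dist_norm)
    then have "exp (t * norm x) \<le> exp (t * (norm z + norm h))"
      using assms by simp
    then have "exp 1 * t * exp_norm t f * exp (t * norm x)
      \<le> exp 1 * t * exp_norm t f * exp (t * (norm z + norm h))"
      using assms exp_norm_nonneg[OF assms] by (intro mult_left_mono) auto
    then show "norm (deriv f x) \<le> ?B"
      using norm_deriv_le_exp_norm[OF assms, of x] by (simp add: exp_add algebra_simps)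
  qed (auto simp: dist_norm)
  with False show ?thesis
    by (simp add: diff_op_def norm_mult norm_divide field_simps)
qed

lemma Emin_diff_op:
  assumes "f \<in> Emin" shows "diff_op h f \<in> Emin"
proof (rule EminI[OF _ norm_diff_op_le_exp_norm[OF assms]])
  have "(\<lambda>z. f (z + h)) holomorphic_on UNIV"
    using holomorphic_on_compose[of "\<lambda>z. z + h" UNIV f, unfolded o_def]
    by (simp add: holomorphic_on_add holomorphic_on_const holomorphic_on_ident Emin_holomorphic[OF assms])
  then show "diff_op h f holomorphic_on UNIV"
    using Emin_holomorphic[OF Emin_deriv[OF assms]] Emin_holomorphic[OF assms]
    by (auto simp: diff_op_def intro!: holomorphic_intros)
qed

lemma exp_norm_diff_op_le:
  assumes "f \<in> Emin" "t > 0"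
  shows "exp_norm t (diff_op h f) \<le> exp 1 * t * exp (t * norm h) * exp_norm t f"
  by (intro exp_norm_le norm_diff_op_le_exp_norm assms)

lemma diff_op_add:
  assumes "f \<in> Emin" "g \<in> Emin"
  shows "diff_op h (\<lambda>z. f z + g z) z = diff_op h f z + diff_op h g z"
proof -
  have "f field_differentiable at z" "g field_differentiable at z"
    using assms by (auto intro: holomorphic_on_imp_differentiable_at[of _ UNIV] Emin_holomorphic)
  then show ?thesis by (simp add: diff_op_def algebra_simps)
qed

lemma diff_op_cmult:
  assumes "f \<in> Emin"
  shows "diff_op h (\<lambda>z. c * f z) z = c * diff_op h f z"
proof -
  have "f field_differentiable at z"
    using assms by (auto intro: holomorphic_on_imp_differentiable_at[of _ UNIV] Emin_holomorphic)
  then show ?thesis by (simp add: diff_op_def algebra_simps)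
qed

section \<open>Topology and bounded operators\<close>

text \<open>Continuity is encoded by norm estimates in which \<open>r\<close> may differ from
  \<open>t\<close>. Such estimates can be verified and composed without reference to open
  sets.\<close>

definition bounded_linear_Emin :: "((complex \<Rightarrow> complex) \<Rightarrow> complex \<Rightarrow> complex) \<Rightarrow> bool" where
  "bounded_linear_Emin T \<longleftrightarrow> T ` Emin \<subseteq> Emin \<and>
     (\<forall>\<phi>\<in>Emin. \<forall>\<psi>\<in>Emin. T (\<lambda>z. \<phi> z + \<psi> z) = (\<lambda>z. T \<phi> z + T \<psi> z)) \<and>
     (\<forall>c. \<forall>\<phi>\<in>Emin. T (\<lambda>z. c * \<phi> z) = (\<lambda>z. c * T \<phi> z)) \<and>
     (\<forall>t>0. \<exists>r>0. \<exists>C. \<forall>\<phi>\<in>Emin. exp_norm t (T \<phi>) \<le> C * exp_norm r \<phi>)"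

lemma bounded_linear_EminD:
  assumes "bounded_linear_Emin T"
  shows "\<phi> \<in> Emin \<Longrightarrow> T \<phi> \<in> Emin"
    and "\<phi> \<in> Emin \<Longrightarrow> \<psi> \<in> Emin \<Longrightarrow> T (\<lambda>z. \<phi> z + \<psi> z) = (\<lambda>z. T \<phi> z + T \<psi> z)"
    and "\<phi> \<in> Emin \<Longrightarrow> T (\<lambda>z. c * \<phi> z) = (\<lambda>z. c * T \<phi> z)"
    and "t > 0 \<Longrightarrow> \<exists>r>0. \<exists>C. \<forall>\<phi>\<in>Emin. exp_norm t (T \<phi>) \<le> C * exp_norm r \<phi>"
  using assms by (auto simp: bounded_linear_Emin_def)

lemma bounded_linear_Emin_diff:
  assumes "bounded_linear_Emin T" "\<phi> \<in> Emin" "\<psi> \<in> Emin"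
  shows "T (\<lambda>z. \<phi> z - \<psi> z) = (\<lambda>z. T \<phi> z - T \<psi> z)"
  using bounded_linear_EminD(2)[OF assms(1,2) Emin_cmult[OF assms(3), of "-1"]]
    bounded_linear_EminD(3)[OF assms(1,3), of "-1"] by simp

lemma openin_Emin_ball:
  assumes "t > 0" "\<epsilon> > 0" "\<phi> \<in> Emin"
  shows "openin Emin_topology {\<psi> \<in> Emin. exp_norm t (\<lambda>z. \<psi> z - \<phi> z) < \<epsilon>}"
  unfolding Emin_topology_def using assms by (intro topology_generated_by_Basis) blast

text \<open>The generating balls are only a subbasis, yet the balls centred at a point form a
  neighbourhood base there: for intersections the smaller index and radius serve, and a ball with
  another centre is recentred by the triangle inequality.\<close>

lemma openin_Emin_imp_ball:
  assumes "openin Emin_topology S" "\<phi> \<in> S"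
  obtains t \<epsilon> where "t > 0" "\<epsilon> > 0" "{\<psi> \<in> Emin. exp_norm t (\<lambda>z. \<psi> z - \<phi> z) < \<epsilon>} \<subseteq> S"
proof -
  define B where "B t \<phi> \<epsilon> = {\<psi> \<in> Emin. exp_norm t (\<lambda>z. \<psi> z - \<phi> z) < \<epsilon>}" for t \<phi> and \<epsilon> :: real
  define G where "G = {B t \<phi> \<epsilon> | t \<phi> \<epsilon>. t > 0 \<and> \<epsilon> > 0 \<and> \<phi> \<in> Emin}"
  have top: "Emin_topology = topology_generated_by G"
    by (simp add: Emin_topology_def G_def B_def)
  have "\<exists>t \<epsilon>. t > 0 \<and> \<epsilon> > 0 \<and> B t \<phi> \<epsilon> \<subseteq> S"
    using assms unfolding top openin_topology_generated_by_iff
  proof (induction arbitrary: \<phi>)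
    case (Int a b)
    from Int.IH(1) Int.prems obtain t1 e1 where 1: "t1 > 0" "e1 > 0" "B t1 \<phi> e1 \<subseteq> a" by blast
    from Int.IH(2) Int.prems obtain t2 e2 where 2: "t2 > 0" "e2 > 0" "B t2 \<phi> e2 \<subseteq> b" by blast
    have "openin Emin_topology a"
      using Int.hyps unfolding top openin_topology_generated_by_iff by blast
    then have "\<phi> \<in> Emin"
      using Int.prems openin_subset topspace_Emin_topology by blast
    then have "exp_norm t1 (\<lambda>z. \<psi> z - \<phi> z) \<le> exp_norm (min t1 t2) (\<lambda>z. \<psi> z - \<phi> z)"
      "exp_norm t2 (\<lambda>z. \<psi> z - \<phi> z) \<le> exp_norm (min t1 t2) (\<lambda>z. \<psi> z - \<phi> z)" if "\<psi> \<in> Emin" for \<psi>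
      using that 1 2 by (intro exp_norm_antimono Emin_diff; simp)+
    then have "B (min t1 t2) \<phi> (min e1 e2) \<subseteq> B t1 \<phi> e1 \<inter> B t2 \<phi> e2"
      unfolding B_def by fastforce
    with 1 2 have "min t1 t2 > 0 \<and> min e1 e2 > 0 \<and> B (min t1 t2) \<phi> (min e1 e2) \<subseteq> a \<inter> b" by auto
    then show ?case by blast
  next
    case (UN K)
    then obtain k where k: "k \<in> K" "\<phi> \<in> k" by blast
    from UN.IH[OF this] show ?case using k(1) by (meson Sup_upper order_trans)
  next
    case (Basis b)
    then obtain t \<phi>0 e where b: "b = B t \<phi>0 e" "t > 0" "e > 0" "\<phi>0 \<in> Emin"
      unfolding G_def by blast
    have \<phi>: "\<phi> \<in> Emin" "e - exp_norm t (\<lambda>z. \<phi> z - \<phi>0 z) > 0"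
      using Basis.prems by (auto simp: b(1) B_def)
    have "\<psi> \<in> b" if \<psi>: "\<psi> \<in> B t \<phi> (e - exp_norm t (\<lambda>z. \<phi> z - \<phi>0 z))" for \<psi>
    proof -
      have "exp_norm t (\<lambda>z. (\<psi> z - \<phi> z) + (\<phi> z - \<phi>0 z))
        \<le> exp_norm t (\<lambda>z. \<psi> z - \<phi> z) + exp_norm t (\<lambda>z. \<phi> z - \<phi>0 z)"
        using \<psi> \<phi> b by (intro exp_norm_triangle Emin_diff) (auto simp: B_def)
      with \<psi> show "\<psi> \<in> b" by (simp add: b(1) B_def)
    qed
    then show ?case using b(2) \<phi>(2) by blast
  qed auto
  with that show thesis by (auto simp: B_def)
qed

lemma limitin_EminI:
  assumes "\<phi> \<in> Emin" "\<And>n. X n \<in> Emin"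
    and "\<And>t. t > 0 \<Longrightarrow> (\<lambda>n. exp_norm t (\<lambda>z. X n z - \<phi> z)) \<longlonglongrightarrow> 0"
  shows "limitin Emin_topology X \<phi> sequentially"
  unfolding limitin_def topspace_Emin_topology
proof (intro conjI allI impI; (elim conjE)?)
  fix S assume "openin Emin_topology S" "\<phi> \<in> S"
  then obtain t e where "t > 0" "e > 0" "{\<psi> \<in> Emin. exp_norm t (\<lambda>z. \<psi> z - \<phi> z) < e} \<subseteq> S"
    by (rule openin_Emin_imp_ball)
  moreover from this have "\<forall>\<^sub>F n in sequentially. exp_norm t (\<lambda>z. X n z - \<phi> z) < e"
    using assms(3) by (intro order_tendstoD(2)) auto
  ultimately show "\<forall>\<^sub>F n in sequentially. X n \<in> S"
    using assms(2) by (auto elim!: eventually_mono)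
qed fact

lemma Hausdorff_Emin: "Hausdorff_space Emin_topology"
  unfolding Hausdorff_space_def topspace_Emin_topology
proof (intro allI impI; elim conjE)
  fix f g assume fg: "f \<in> Emin" "g \<in> Emin" "f \<noteq> g"
  \<comment> \<open>Half the distance in the norm of index 1, so that the balls of radius
    \<open>e\<close> around \<open>f\<close> and \<open>g\<close> are disjoint.\<close>
  define e where "e = exp_norm 1 (\<lambda>z. f z - g z) / 2"
  have e: "e > 0"
    using Emin_eq_zero[OF Emin_diff[OF fg(1,2)], of 1] fg(3) by (force simp: e_def)
  have symm: "exp_norm 1 (\<lambda>z. f z - \<psi> z) = exp_norm 1 (\<lambda>z. \<psi> z - f z)" for \<psi>
    by (simp add: exp_norm_def norm_minus_commute)
  have "disjnt {\<psi> \<in> Emin. exp_norm 1 (\<lambda>z. \<psi> z - f z) < e} {\<psi> \<in> Emin. exp_norm 1 (\<lambda>z. \<psi> z - g z) < e}"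
  proof (unfold disjnt_iff, clarify)
    fix \<psi> assume \<psi>: "\<psi> \<in> Emin" "exp_norm 1 (\<lambda>z. \<psi> z - f z) < e" "exp_norm 1 (\<lambda>z. \<psi> z - g z) < e"
    have "exp_norm 1 (\<lambda>z. (f z - \<psi> z) + (\<psi> z - g z))
        \<le> exp_norm 1 (\<lambda>z. f z - \<psi> z) + exp_norm 1 (\<lambda>z. \<psi> z - g z)"
      by (intro exp_norm_triangle Emin_diff fg \<psi>) simp
    then show False using \<psi> symm[of \<psi>] by (simp add: e_def)
  qed
  moreover have "exp_norm 1 (\<lambda>z. 0) \<le> 0" by (rule exp_norm_le) simp
  ultimately show "\<exists>S T. openin Emin_topology S \<and> openin Emin_topology T \<and> f \<in> S \<and> g \<in> T \<and> disjnt S T"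
    using fg e by (intro exI[of _ "{\<psi> \<in> Emin. exp_norm 1 (\<lambda>z. \<psi> z - f z) < e}"]
        exI[of _ "{\<psi> \<in> Emin. exp_norm 1 (\<lambda>z. \<psi> z - g z) < e}"]) (auto intro: openin_Emin_ball)
qed

lemma bounded_linear_imp_continuous_linear_op:
  assumes "bounded_linear_Emin T"
  shows "continuous_linear_op T"
proof -
  have T: "T \<phi> \<in> Emin" if "\<phi> \<in> Emin" for \<phi> using bounded_linear_EminD(1)[OF assms that] .
  have "continuous_map Emin_topology Emin_topology T"
    unfolding continuous_map topspace_Emin_topology
  proof (intro conjI allI impI)
    show "T ` Emin \<subseteq> Emin" using T by blast
    fix S assume S: "openin Emin_topology S"
    show "openin Emin_topology {x \<in> Emin. T x \<in> S}"
    proof (subst openin_subopen, clarify)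
      fix \<phi> assume \<phi>: "\<phi> \<in> Emin" "T \<phi> \<in> S"
      obtain t e where te: "t > 0" "e > 0" "{\<psi> \<in> Emin. exp_norm t (\<lambda>z. \<psi> z - T \<phi> z) < e} \<subseteq> S"
        using openin_Emin_imp_ball[OF S \<phi>(2)] by blast
      obtain r C where rC: "r > 0" "\<And>\<psi>. \<psi> \<in> Emin \<Longrightarrow> exp_norm t (T \<psi>) \<le> C * exp_norm r \<psi>"
        using bounded_linear_EminD(4)[OF assms te(1)] by blast
      \<comment> \<open>Adding 1 to the absolute value keeps the divisor positive, since nothing is
        known about the sign of \<open>C\<close>.\<close>
      define d where "d = e / (\<bar>C\<bar> + 1)"
      have d: "d > 0" using te by (simp add: d_def add_nonneg_pos)
      have "exp_norm t (\<lambda>z. T \<psi> z - T \<phi> z) < e"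
        if "\<psi> \<in> Emin" "exp_norm r (\<lambda>z. \<psi> z - \<phi> z) < d" for \<psi>
      proof -
        have E: "(\<lambda>z. \<psi> z - \<phi> z) \<in> Emin" using that \<phi> by (intro Emin_diff)
        have "exp_norm t (\<lambda>z. T \<psi> z - T \<phi> z) \<le> C * exp_norm r (\<lambda>z. \<psi> z - \<phi> z)"
          using rC(2)[OF E] bounded_linear_Emin_diff[OF assms that(1) \<phi>(1)] by simp
        also have "\<dots> \<le> (\<bar>C\<bar> + 1) * exp_norm r (\<lambda>z. \<psi> z - \<phi> z)"
          using exp_norm_nonneg[OF E rC(1)] by (intro mult_right_mono) auto
        also have "\<dots> < (\<bar>C\<bar> + 1) * d" using that by (intro mult_strict_left_mono) auto
        finally show ?thesis by (simp add: d_def add_nonneg_pos)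
      qed
      moreover have "exp_norm r (\<lambda>z. \<phi> z - \<phi> z) \<le> 0" by (rule exp_norm_le) simp
      ultimately show "\<exists>B. openin Emin_topology B \<and> \<phi> \<in> B \<and> B \<subseteq> {x \<in> Emin. T x \<in> S}"
        using te(3) T \<phi> d openin_Emin_ball[OF rC(1) d \<phi>(1)]
        by (intro exI[of _ "{\<psi> \<in> Emin. exp_norm r (\<lambda>z. \<psi> z - \<phi> z) < d}"]) (auto simp: subset_iff)
    qed
  qed
  then show ?thesis using assms by (simp add: continuous_linear_op_def bounded_linear_Emin_def)
qed

section \<open>Multiplication by an affine function\<close>

lemma Emin_mult_affine_bound:
  assumes "\<phi> \<in> Emin" "t > 0"
  shows "norm ((z + c) * \<phi> z) \<le> (2 / t + norm c) * exp_norm (t / 2) \<phi> * exp (t * norm z)"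
proof -
  \<comment> \<open>The weight \<open>exp (t * norm z)\<close> is split into two equal factors: one
    absorbs the growth of \<open>z + c\<close> because \<open>x \<le> exp x\<close>, the other
    controls \<open>\<phi>\<close>. This costs the passage from \<open>t\<close> to
    \<open>t / 2\<close>.\<close>
  have "t / 2 * norm z \<le> exp (t / 2 * norm z)"
    using exp_ge_add_one_self[of "t / 2 * norm z"] by linarith
  then have "2 / t * (t / 2 * norm z) \<le> 2 / t * exp (t / 2 * norm z)"
    using assms(2) by (intro mult_left_mono) auto
  then have "norm z \<le> 2 / t * exp (t / 2 * norm z)" using assms(2) by simp
  moreover have "norm c * 1 \<le> norm c * exp (t / 2 * norm z)"
    using assms(2) by (intro mult_left_mono) auto
  ultimately have "norm (z + c) \<le> (2 / t + norm c) * exp (t / 2 * norm z)"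
    using norm_triangle_ineq[of z c] by (simp add: distrib_right)
  then have "norm (z + c) * norm (\<phi> z)
      \<le> ((2 / t + norm c) * exp (t / 2 * norm z)) * (exp_norm (t / 2) \<phi> * exp (t / 2 * norm z))"
    using assms by (intro mult_mono norm_le_exp_norm) auto
  also have "\<dots> = (2 / t + norm c) * exp_norm (t / 2) \<phi> * (exp (t / 2 * norm z) * exp (t / 2 * norm z))"
    by (simp add: ac_simps)
  also have "exp (t / 2 * norm z) * exp (t / 2 * norm z) = exp (t * norm z)"
    by (simp add: exp_add[symmetric])
  finally show ?thesis by (simp add: norm_mult)
qed

lemma Emin_mult_affine:
  assumes "\<phi> \<in> Emin" shows "(\<lambda>z. (z + c) * \<phi> z) \<in> Emin"
  by (rule EminI[OF _ Emin_mult_affine_bound[OF assms]])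
    (intro holomorphic_intros Emin_holomorphic assms)

text \<open>With \<open>c = 0\<close> this is \<open>Z\<close>; with
  \<open>c = \<sigma> / \<alpha>\<close> it is the left factor of \<open>U\<close> in the case of
  conjugate parameters.\<close>

lemma bounded_linear_mult_affine: "bounded_linear_Emin (\<lambda>\<phi> z. (z + c) * \<phi> z)"
  unfolding bounded_linear_Emin_def
proof (intro conjI ballI allI impI)
  fix t :: real assume t: "t > 0"
  have "exp_norm t (\<lambda>z. (z + c) * \<phi> z) \<le> (2 / t + norm c) * exp_norm (t / 2) \<phi>"
    if "\<phi> \<in> Emin" for \<phi>
    by (intro exp_norm_le Emin_mult_affine_bound that t)
  moreover have "t / 2 > 0" using t by simp
  ultimately show "\<exists>r>0. \<exists>C. \<forall>\<phi>\<in>Emin. exp_norm t (\<lambda>z. (z + c) * \<phi> z) \<le> C * exp_norm r \<phi>"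
    by blast
next
  show "(\<lambda>\<phi> z. (z + c) * \<phi> z) ` Emin \<subseteq> Emin" using Emin_mult_affine by blast
qed (simp_all add: algebra_simps)

section \<open>Density of polynomials and uniqueness of extensions\<close>

lemma poly_in_Emin: "poly p \<in> Emin"
proof (induction p)
  case (pCons a p)
  have "(\<lambda>z. a + (z + 0) * poly p z) \<in> Emin"
    by (intro Emin_add Emin_const Emin_mult_affine pCons.IH)
  moreover have "poly (pCons a p) = (\<lambda>z. a + (z + 0) * poly p z)" by auto
  ultimately show ?case by simp
qed (use Emin_const[of 0] in simp)

text \<open>Serves both the Taylor and the Neumann series; its case \<open>n = 0\<close> bounds the
  sum itself.\<close>

lemma norm_tail_le_geometric:
  fixes c :: "nat \<Rightarrow> complex"
  assumes "\<And>k. norm (c k) \<le> K * (1 / 2) ^ k"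
  shows "norm (suminf c - (\<Sum>k<n. c k)) \<le> 2 * K * (1 / 2) ^ n"
proof -
  have geo: "(\<lambda>k. K * (1 / 2) ^ (k + n)) sums (2 * K * (1 / 2) ^ n)" for n
    using sums_mult[OF geometric_sums[of "1 / 2 :: real"], of "K * (1 / 2) ^ n"]
    by (simp add: power_add ac_simps)
  have sum: "summable c"
    using summable_comparison_test'[OF sums_summable[OF geo[of 0]], of 0 c] assms by simp
  have "norm (\<Sum>k. c (k + n)) \<le> (\<Sum>k. K * (1 / 2) ^ (k + n))"
    using assms sums_summable[OF geo] by (intro norm_suminf_le)
  then show "norm (suminf c - (\<Sum>k<n. c k)) \<le> 2 * K * (1 / 2) ^ n"
    using suminf_minus_initial_segment[OF sum, of n] sums_unique[OF geo] by simp
qed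

lemma polys_sequentially_dense:
  assumes "\<phi> \<in> Emin"
  obtains p where "limitin Emin_topology (\<lambda>n. poly (p n)) \<phi> sequentially"
proof -
  define a where "a k = (deriv ^^ k) \<phi> 0 / fact k" for k
  define p where "p n = (\<Sum>k<n. monom (a k) k)" for n
  have "limitin Emin_topology (\<lambda>n. poly (p n)) \<phi> sequentially"
  proof (rule limitin_EminI[OF assms poly_in_Emin])
    fix t :: real assume t: "t > 0"
    \<comment> \<open>Estimating the coefficients with a smaller norm gains the factor \<open>(1 / 2) ^ k\<close>.\<close>
    define r where "r = t / (2 * exp 1)"
    have r: "r > 0" "exp 1 * r = t / 2" using t by (simp_all add: r_def)
    have summand_le: "norm (a k * z ^ k) \<le> exp_norm r \<phi> * exp (t * norm z) * (1 / 2) ^ k" for k z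
    proof -
      have "norm ((deriv ^^ k) \<phi> 0) \<le> exp_norm r ((deriv ^^ k) \<phi>)"
        using norm_le_exp_norm[OF Emin_higher_deriv[OF assms] r(1), of k 0] by simp
      also have "\<dots> \<le> (t / 2) ^ k * exp_norm r \<phi>"
        using exp_norm_higher_deriv_le[OF assms r(1), of k] r(2) by simp
      finally have "norm (a k * z ^ k) \<le> (t / 2) ^ k * exp_norm r \<phi> / fact k * norm z ^ k"
        by (auto simp: a_def norm_mult norm_divide norm_power intro!: mult_right_mono divide_right_mono)
      also have "\<dots> = exp_norm r \<phi> * ((t * norm z) ^ k / fact k) * (1 / 2) ^ k"
        by (simp add: power_mult_distrib power_divide field_simps)
      \<comment> \<open>A single term of the exponential series is at most the sum, all terms being
        nonnegative.\<close>
      also have "(t * norm z) ^ k / fact k \<le> exp (t * norm z)"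
        using sum_le_suminf[OF summable_exp_generic[of "t * norm z"], of "{k}"] t
        by (simp add: exp_def divide_inverse ac_simps)
      finally show ?thesis using exp_norm_nonneg[OF assms r(1)]
        by (simp add: mult_left_mono mult_right_mono)
    qed
    have "norm (poly (p n) z - \<phi> z) \<le> 2 * exp_norm r \<phi> * (1 / 2) ^ n * exp (t * norm z)" for n z
    proof -
      have "(\<lambda>k. a k * z ^ k) sums \<phi> z"
        using holomorphic_power_series[of \<phi> 0 "norm z + 1" z] Emin_holomorphic[OF assms]
        by (simp add: a_def)
      then show ?thesis
        using norm_tail_le_geometric[OF summand_le, of z n]
        by (simp add: sums_iff p_def poly_sum poly_monom norm_minus_commute ac_simps)
    qed
    then have le: "exp_norm t (\<lambda>z. poly (p n) z - \<phi> z) \<le> 2 * exp_norm r \<phi> * (1 / 2) ^ n" for n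
      by (rule exp_norm_le)
    have "(\<lambda>n. 2 * exp_norm r \<phi> * (1 / 2) ^ n) \<longlonglongrightarrow> 0"
      by (intro tendsto_mult_right_zero LIMSEQ_power_zero) simp
    then show "(\<lambda>n. exp_norm t (\<lambda>z. poly (p n) z - \<phi> z)) \<longlonglongrightarrow> 0"
      by (rule tendsto_sandwich[OF _ _ tendsto_const, rotated 2])
        (intro always_eventually allI exp_norm_nonneg Emin_diff poly_in_Emin le assms t)+
  qed
  then show thesis by (rule that)
qed

text \<open>Both operators agree along a sequence of polynomials tending to \<open>\<phi>\<close>,
  and limits are unique in a Hausdorff space.\<close>

lemma continuous_linear_extension_unique:
  assumes "continuous_linear_extension A T" "continuous_linear_extension A T'" "\<phi> \<in> Emin"
  shows "T \<phi> = T' \<phi>"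
proof -
  obtain p where p: "limitin Emin_topology (\<lambda>n. poly (p n)) \<phi> sequentially"
    using polys_sequentially_dense[OF assms(3)] by blast
  have "limitin Emin_topology (\<lambda>n. poly (A (p n))) (S \<phi>) sequentially"
    if "continuous_linear_extension A S" for S
    using that continuous_map_limit[OF _ p, of Emin_topology S]
    by (simp add: continuous_linear_extension_def continuous_linear_op_def o_def)
  from this[OF assms(1)] this[OF assms(2)] show ?thesis
    by (rule limitin_Hausdorff_unique) (simp_all add: Hausdorff_Emin)
qed

section \<open>Inversion by a Neumann series\<close>

lemma Neumann_inverse:
  assumes A: "bounded_linear_Emin A" and "t0 > 0"
    and contr: "\<And>t \<phi>. 0 < t \<Longrightarrow> t \<le> t0 \<Longrightarrow> \<phi> \<in> Emin \<Longrightarrow> exp_norm t (A \<phi>) \<le> exp_norm t \<phi> / 2"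
  obtains B where "bounded_linear_Emin B"
    and "\<And>\<phi>. \<phi> \<in> Emin \<Longrightarrow> B (\<lambda>z. \<phi> z - A \<phi> z) = \<phi>"
    and "\<And>\<phi>. \<phi> \<in> Emin \<Longrightarrow> (\<lambda>z. B \<phi> z - A (B \<phi>) z) = \<phi>"
proof -
  \<comment> \<open>The series is summed pointwise. The geometric bounds below supply locally
    uniform convergence, hence holomorphy, and the growth estimates.\<close>
  define B where "B \<phi> z = (\<Sum>k. (A ^^ k) \<phi> z)" for \<phi> z
  note A1 = bounded_linear_EminD(1)[OF A] and A2 = bounded_linear_EminD(2)[OF A]
  have pow: "(A ^^ k) \<phi> \<in> Emin" if "\<phi> \<in> Emin" for \<phi> k
    by (induction k) (auto intro: A1 that)
  have summand_le: "norm ((A ^^ k) \<phi> z) \<le> exp_norm t \<phi> * exp (t * norm z) * (1 / 2) ^ k"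
    if "\<phi> \<in> Emin" "0 < t" "t \<le> t0" for \<phi> t k z
  proof -
    have "exp_norm t ((A ^^ k) \<phi>) \<le> exp_norm t \<phi> * (1 / 2) ^ k"
    proof (induction k)
      case (Suc k)
      then show ?case using contr[OF that(2,3) pow[OF that(1)], of k] by simp
    qed simp
    then have "exp_norm t ((A ^^ k) \<phi>) * exp (t * norm z)
        \<le> exp_norm t \<phi> * (1 / 2) ^ k * exp (t * norm z)"
      by (intro mult_right_mono) auto
    from order_trans[OF norm_le_exp_norm[OF pow[OF that(1)] that(2)] this] show ?thesis
      by (simp add: ac_simps)
  qed
  have tail: "norm (B \<phi> z - (\<Sum>k<n. (A ^^ k) \<phi> z))
      \<le> 2 * exp_norm t \<phi> * (1 / 2) ^ n * exp (t * norm z)"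
    if "\<phi> \<in> Emin" "0 < t" "t \<le> t0" for \<phi> t n z
    using norm_tail_le_geometric[OF summand_le[OF that], of z n] by (simp add: B_def ac_simps)
  \<comment> \<open>The contraction is available only up to \<open>t0\<close>. For larger
    \<open>t\<close> the estimate at \<open>t0\<close> is used, whose exponential factor is
    smaller.\<close>
  have bound: "norm (B \<phi> z) \<le> 2 * exp_norm (min t t0) \<phi> * exp (t * norm z)"
    if "\<phi> \<in> Emin" "t > 0" for \<phi> t z
  proof -
    have "norm (B \<phi> z) \<le> 2 * exp_norm (min t t0) \<phi> * exp (min t t0 * norm z)"
      using tail[OF that(1), of "min t t0" z 0] that(2) assms(2) by simp
    also have "\<dots> \<le> 2 * exp_norm (min t t0) \<phi> * exp (t * norm z)"
      using that assms(2) by (intro mult_left_mono) (auto intro: mult_right_mono exp_norm_nonneg)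
    finally show ?thesis .
  qed
  have hol: "B \<phi> holomorphic_on UNIV" if \<phi>: "\<phi> \<in> Emin" for \<phi>
  proof (rule holomorphic_uniform_sequence[where f = "\<lambda>n z. \<Sum>k<n. (A ^^ k) \<phi> z"])
    show "(\<lambda>z. \<Sum>k<n. (A ^^ k) \<phi> z) holomorphic_on UNIV" for n
      using pow[OF \<phi>] by (intro holomorphic_intros Emin_holomorphic)
    fix x :: complex
    have "uniform_limit (cball x 1) (\<lambda>n z. \<Sum>k<n. (A ^^ k) \<phi> z) (\<lambda>z. \<Sum>k. (A ^^ k) \<phi> z) sequentially"
    proof (rule Weierstrass_m_test)
      show "summable (\<lambda>k. exp_norm t0 \<phi> * exp (t0 * (norm x + 1)) * (1 / 2) ^ k)"
        by (intro summable_mult summable_geometric) simp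
      fix k z assume "z \<in> cball x 1"
      then have "norm z \<le> norm x + 1"
        using norm_triangle_ineq2[of z x] by (simp add: dist_norm norm_minus_commute)
      then have "exp (t0 * norm z) \<le> exp (t0 * (norm x + 1))" using assms(2) by simp
      then have "exp_norm t0 \<phi> * exp (t0 * norm z) * (1 / 2) ^ k
          \<le> exp_norm t0 \<phi> * exp (t0 * (norm x + 1)) * (1 / 2) ^ k"
        using exp_norm_nonneg[OF \<phi> assms(2)] by (intro mult_right_mono mult_left_mono) auto
      with summand_le[OF \<phi> assms(2), of k z]
      show "norm ((A ^^ k) \<phi> z) \<le> exp_norm t0 \<phi> * exp (t0 * (norm x + 1)) * (1 / 2) ^ k"
        by simp
    qed
    then have "uniform_limit (cball x 1) (\<lambda>n z. \<Sum>k<n. (A ^^ k) \<phi> z) (B \<phi>) sequentially"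
      by (simp add: B_def[abs_def])
    then show "\<exists>d>0. cball x d \<subseteq> UNIV \<and>
        uniform_limit (cball x d) (\<lambda>n z. \<Sum>k<n. (A ^^ k) \<phi> z) (B \<phi>) sequentially"
      by (intro exI[of _ 1]) simp
  qed simp
  have B1: "B \<phi> \<in> Emin" if "\<phi> \<in> Emin" for \<phi>
    by (rule EminI[OF hol[OF that] bound[OF that]])
  have zeroI: "f = (\<lambda>z. 0)" if "f \<in> Emin" "exp_norm t0 f \<le> 0" for f
    using Emin_eq_zero[OF that(1) assms(2) that(2)] by blast
  have right: "(\<lambda>z. B \<phi> z - A (B \<phi>) z) = \<phi>" if \<phi>: "\<phi> \<in> Emin" for \<phi>
  proof -
    define S where "S n = (\<lambda>z. \<Sum>k<n. (A ^^ k) \<phi> z)" for n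
    \<comment> \<open>Recursion for the partial sums. Membership is proved in the same induction
      because additivity of \<open>A\<close> is known only on \<open>Emin\<close>.\<close>
    have S: "S n \<in> Emin \<and> S (Suc n) = (\<lambda>z. \<phi> z + A (S n) z)" for n
    proof (induction n)
      case 0
      \<comment> \<open>\<open>S 0\<close> is the zero function, which \<open>A\<close> fixes by
        homogeneity with factor 0.\<close>
      have "A (\<lambda>z. 0 * \<phi> z) = (\<lambda>z. 0 * A \<phi> z)" by (rule bounded_linear_EminD(3)[OF A \<phi>])
      then show ?case using Emin_const[of 0] by (simp add: S_def)
    next
      case (Suc n)
      have *: "S (Suc n) = (\<lambda>z. S n z + (A ^^ n) \<phi> z)" by (simp add: S_def)
      have AS: "A (S (Suc n)) = (\<lambda>z. A (S n) z + (A ^^ Suc n) \<phi> z)"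
        unfolding * using A2[OF conjunct1[OF Suc.IH] pow[OF \<phi>], of n] by simp
      have "S (Suc (Suc n)) z = \<phi> z + A (S (Suc n)) z" for z
        unfolding AS using fun_cong[OF conjunct2[OF Suc.IH], of z] by (simp add: S_def)
      moreover have "S (Suc n) \<in> Emin"
        unfolding * using Suc.IH pow[OF \<phi>] by (intro Emin_add) auto
      ultimately show ?case by blast
    qed
    have le: "exp_norm t0 (\<lambda>z. B \<phi> z - S n z) \<le> 2 * exp_norm t0 \<phi> * (1 / 2) ^ n" for n
      using tail[OF \<phi> assms(2)] by (intro exp_norm_le) (simp add: S_def)
    let ?d = "\<lambda>z. B \<phi> z - A (B \<phi>) z - \<phi> z"
    have "exp_norm t0 ?d \<le> 2 * exp_norm t0 \<phi> * (1 / 2) ^ n" for n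
    proof -
      have E: "(\<lambda>z. B \<phi> z - S n z) \<in> Emin" for n using B1[OF \<phi>] S by (intro Emin_diff) auto
      \<comment> \<open>The recursion for \<open>S\<close> eliminates \<open>\<phi>\<close>, leaving
        one tail and the image of another under \<open>A\<close>; both tend to 0 in norm.\<close>
      have "?d = (\<lambda>z. (B \<phi> z - S (Suc n) z) + (-1) * A (\<lambda>z. B \<phi> z - S n z) z)"
        using S[of n] B1[OF \<phi>] by (simp add: bounded_linear_Emin_diff[OF A] algebra_simps)
      moreover have "exp_norm t0 (\<lambda>z. (B \<phi> z - S (Suc n) z) + (-1) * A (\<lambda>z. B \<phi> z - S n z) z)
          \<le> exp_norm t0 (\<lambda>z. B \<phi> z - S (Suc n) z) + exp_norm t0 (\<lambda>z. (-1) * A (\<lambda>z. B \<phi> z - S n z) z)"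
        by (intro exp_norm_triangle E Emin_cmult A1 assms(2))
      moreover have "exp_norm t0 (\<lambda>z. (-1) * A (\<lambda>z. B \<phi> z - S n z) z)
          \<le> exp_norm t0 (\<lambda>z. B \<phi> z - S n z) / 2"
        using exp_norm_cmult_le[OF A1[OF E] assms(2), of "-1" n] contr[OF assms(2) _ E, of n] by simp
      ultimately show ?thesis using le[of n] le[of "Suc n"] by simp
    qed
    moreover have "(\<lambda>n. 2 * exp_norm t0 \<phi> * (1 / 2) ^ n) \<longlonglongrightarrow> 0"
      by (intro tendsto_mult_right_zero LIMSEQ_power_zero) simp
    ultimately have "exp_norm t0 ?d \<le> 0" by (intro LIMSEQ_le_const) auto
    moreover have "?d \<in> Emin" by (intro Emin_diff B1 A1 \<phi>)
    ultimately have "?d = (\<lambda>z. 0)" by (intro zeroI)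
    then show ?thesis by (simp add: fun_eq_iff)
  qed
  have left: "B (\<lambda>z. \<phi> z - A \<phi> z) = \<phi>" if \<phi>: "\<phi> \<in> Emin" for \<phi>
  proof -
    let ?\<psi> = "\<lambda>z. \<phi> z - A \<phi> z"
    have \<psi>: "?\<psi> \<in> Emin" by (intro Emin_diff A1 \<phi>)
    let ?d = "\<lambda>z. B ?\<psi> z - \<phi> z"
    have d: "?d \<in> Emin" by (intro Emin_diff B1 \<psi> \<phi>)
    \<comment> \<open>By the right inverse property \<open>?d\<close> is a fixed point of
      \<open>A\<close>; as \<open>A\<close> at least halves the norm of index \<open>t0\<close>, it
      must vanish.\<close>
    have "A ?d = (\<lambda>z. A (B ?\<psi>) z - A \<phi> z)"
      by (rule bounded_linear_Emin_diff[OF A B1[OF \<psi>] \<phi>])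
    also have "\<dots> = ?d" using right[OF \<psi>] by (auto simp: fun_eq_iff algebra_simps)
    finally have "exp_norm t0 ?d \<le> 0" using contr[OF assms(2) _ d] by simp
    then have "?d = (\<lambda>z. 0)" by (rule zeroI[OF d])
    then show ?thesis by (simp add: fun_eq_iff)
  qed
  have "bounded_linear_Emin B"
    unfolding bounded_linear_Emin_def
  proof (intro conjI ballI allI impI)
    show "B ` Emin \<subseteq> Emin" using B1 by blast
    fix t :: real assume t: "t > 0"
    have "exp_norm t (B \<phi>) \<le> 2 * exp_norm (min t t0) \<phi>" if "\<phi> \<in> Emin" for \<phi>
      by (intro exp_norm_le bound that t)
    moreover have "min t t0 > 0" using t assms(2) by simp
    ultimately show "\<exists>r>0. \<exists>C. \<forall>\<phi>\<in>Emin. exp_norm t (B \<phi>) \<le> C * exp_norm r \<phi>" by blast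
  next
    fix \<phi> \<psi> assume E: "\<phi> \<in> Emin" "\<psi> \<in> Emin"
    let ?b = "\<lambda>z. B \<phi> z + B \<psi> z"
    \<comment> \<open>Linearity of \<open>B\<close> comes from that of \<open>A\<close>: the
      operator \<open>1 - A\<close> sends \<open>?b\<close> to the desired argument, and
      \<open>B\<close> undoes it.\<close>
    have "(\<lambda>z. ?b z - A ?b z) = (\<lambda>z. (B \<phi> z - A (B \<phi>) z) + (B \<psi> z - A (B \<psi>) z))"
      by (simp add: A2[OF B1 B1] E algebra_simps)
    also have "\<dots> = (\<lambda>z. \<phi> z + \<psi> z)"
      using right[OF E(1)] right[OF E(2)] by (simp add: fun_eq_iff)
    finally show "B (\<lambda>z. \<phi> z + \<psi> z) = ?b"
      using left[OF Emin_add[OF B1[OF E(1)] B1[OF E(2)]]] by simp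
  next
    fix c \<phi> assume E: "\<phi> \<in> Emin"
    let ?b = "\<lambda>z. c * B \<phi> z"
    have "(\<lambda>z. ?b z - A ?b z) = (\<lambda>z. c * (B \<phi> z - A (B \<phi>) z))"
      by (simp add: bounded_linear_EminD(3)[OF A B1] E right_diff_distrib)
    also have "\<dots> = (\<lambda>z. c * \<phi> z)" using right[OF E] by (simp add: fun_eq_iff)
    finally show "B (\<lambda>z. c * \<phi> z) = ?b" using left[OF Emin_cmult[OF B1[OF E]], of c] by simp
  qed
  then show thesis using left right by (rule that)
qed

section \<open>Boundedness and contraction of difference operators\<close>

lemma bounded_linear_diff_op: "bounded_linear_Emin (\<lambda>\<phi> z. \<alpha> * diff_op h \<phi> z)"
  unfolding bounded_linear_Emin_def
proof (intro conjI ballI allI impI)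
  fix t :: real assume t: "t > 0"
  have "exp_norm t (\<lambda>z. \<alpha> * diff_op h \<phi> z)
      \<le> (norm \<alpha> * (exp 1 * t * exp (t * norm h))) * exp_norm t \<phi>" if "\<phi> \<in> Emin" for \<phi>
    using exp_norm_cmult_le[OF Emin_diff_op[OF that] t, of \<alpha> h]
      mult_left_mono[OF exp_norm_diff_op_le[OF that t, of h], of "norm \<alpha>"]
    by (simp add: ac_simps)
  with t show "\<exists>r>0. \<exists>C. \<forall>\<phi>\<in>Emin. exp_norm t (\<lambda>z. \<alpha> * diff_op h \<phi> z) \<le> C * exp_norm r \<phi>"
    by blast
qed (auto intro: Emin_cmult Emin_diff_op simp: diff_op_add diff_op_cmult algebra_simps)

lemma diff_op_small:
  obtains t0 where "t0 > 0"
    and "\<And>t \<phi>. 0 < t \<Longrightarrow> t \<le> t0 \<Longrightarrow> \<phi> \<in> Emin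
      \<Longrightarrow> exp_norm t (\<lambda>z. \<alpha> * diff_op h \<phi> z) \<le> exp_norm t \<phi> / 2"
proof -
  \<comment> \<open>For \<open>t \<le> 1\<close> the factor \<open>exp (t * norm h)\<close> is at
    most \<open>exp (norm h)\<close>, and \<open>t \<le> 1 / K\<close> then gives the constant 1/2.
    The summand 1 makes \<open>K\<close> positive even if \<open>\<alpha> = 0\<close>.\<close>
  define K where "K = 2 * norm \<alpha> * exp 1 * exp (norm h) + 1"
  have K: "K > 0" by (simp add: K_def add_nonneg_pos)
  have "exp_norm t (\<lambda>z. \<alpha> * diff_op h \<phi> z) \<le> exp_norm t \<phi> / 2"
    if t: "0 < t" "t \<le> min 1 (1 / K)" and \<phi>: "\<phi> \<in> Emin" for t \<phi>
  proof -
    have "exp_norm t (\<lambda>z. \<alpha> * diff_op h \<phi> z)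
        \<le> norm \<alpha> * (exp 1 * t * exp (t * norm h) * exp_norm t \<phi>)"
      using exp_norm_cmult_le[OF Emin_diff_op[OF \<phi>] t(1), of \<alpha> h]
        mult_left_mono[OF exp_norm_diff_op_le[OF \<phi> t(1), of h], of "norm \<alpha>"] by simp
    also have "\<dots> \<le> norm \<alpha> * (exp 1 * t * exp (norm h) * exp_norm t \<phi>)"
      using t exp_norm_nonneg[OF \<phi> t(1)]
      by (intro mult_left_mono mult_right_mono) (auto simp: mult_left_le_one_le)
    also have "\<dots> = (norm \<alpha> * exp 1 * exp (norm h) * t) * exp_norm t \<phi>" by (simp add: ac_simps)
    also have "\<dots> \<le> (1 / 2) * exp_norm t \<phi>"
    proof (rule mult_right_mono[OF _ exp_norm_nonneg[OF \<phi> t(1)]])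
      have "t * K \<le> 1" using t K by (simp add: field_simps)
      then show "norm \<alpha> * exp 1 * exp (norm h) * t \<le> 1 / 2"
        using t(1) by (simp add: K_def algebra_simps)
    qed
    finally show ?thesis by simp
  qed
  then show thesis using that[of "min 1 (1 / K)"] K by simp
qed

lemma bounded_linear_id_minus:
  assumes A: "bounded_linear_Emin A"
  shows "bounded_linear_Emin (\<lambda>\<phi> z. \<phi> z - A \<phi> z)"
  unfolding bounded_linear_Emin_def
proof (intro conjI ballI allI impI)
  show "(\<lambda>\<phi> z. \<phi> z - A \<phi> z) ` Emin \<subseteq> Emin"
    using bounded_linear_EminD(1)[OF A] by (auto intro: Emin_diff)
  fix t :: real assume t: "t > 0"
  obtain r C where rC: "r > 0" "\<And>\<phi>. \<phi> \<in> Emin \<Longrightarrow> exp_norm t (A \<phi>) \<le> C * exp_norm r \<phi>"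
    using bounded_linear_EminD(4)[OF A t] by blast
  \<comment> \<open>The identity is estimated at index \<open>t\<close> and \<open>A\<close> at
    index \<open>r\<close>; the norm of index \<open>min t r\<close> dominates both.\<close>
  have "exp_norm t (\<lambda>z. \<phi> z - A \<phi> z) \<le> (1 + \<bar>C\<bar>) * exp_norm (min t r) \<phi>" if \<phi>: "\<phi> \<in> Emin" for \<phi>
  proof -
    have A\<phi>: "A \<phi> \<in> Emin" by (rule bounded_linear_EminD(1)[OF A \<phi>])
    have "exp_norm t (\<lambda>z. \<phi> z + (-1) * A \<phi> z) \<le> exp_norm t \<phi> + exp_norm t (\<lambda>z. (-1) * A \<phi> z)"
      by (intro exp_norm_triangle Emin_cmult \<phi> A\<phi> t)
    moreover have "exp_norm t (\<lambda>z. (-1) * A \<phi> z) \<le> exp_norm t (A \<phi>)"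
      using exp_norm_cmult_le[OF A\<phi> t, of "-1"] by simp
    moreover have "exp_norm t (A \<phi>) \<le> \<bar>C\<bar> * exp_norm (min t r) \<phi>"
    proof -
      have "C * exp_norm r \<phi> \<le> \<bar>C\<bar> * exp_norm (min t r) \<phi>"
        using t rC(1) \<phi> by (intro mult_mono exp_norm_antimono exp_norm_nonneg) auto
      with rC(2)[OF \<phi>] show ?thesis by simp
    qed
    moreover have "exp_norm t \<phi> \<le> exp_norm (min t r) \<phi>"
      using t rC(1) \<phi> by (intro exp_norm_antimono) auto
    ultimately show ?thesis by (simp add: distrib_right)
  qed
  moreover have "min t r > 0" using t rC(1) by simp
  ultimately show "\<exists>r>0. \<exists>C. \<forall>\<phi>\<in>Emin. exp_norm t (\<lambda>z. \<phi> z - A \<phi> z) \<le> C * exp_norm r \<phi>"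
    by blast
qed (simp_all add: bounded_linear_EminD(2,3)[OF A] algebra_simps)

lemma bounded_linear_Emin_compose:
  assumes S: "bounded_linear_Emin S" and T: "bounded_linear_Emin T"
  shows "bounded_linear_Emin (S \<circ> T)"
  unfolding bounded_linear_Emin_def
proof (intro conjI ballI allI impI)
  note ST = bounded_linear_EminD[OF S] bounded_linear_EminD[OF T]
  show "(S \<circ> T) ` Emin \<subseteq> Emin" using ST(1,5) by auto
  show "(S \<circ> T) (\<lambda>z. \<phi> z + \<psi> z) = (\<lambda>z. (S \<circ> T) \<phi> z + (S \<circ> T) \<psi> z)"
    if "\<phi> \<in> Emin" "\<psi> \<in> Emin" for \<phi> \<psi>
    using that by (simp add: ST(2,5,6))
  show "(S \<circ> T) (\<lambda>z. c * \<phi> z) = (\<lambda>z. c * (S \<circ> T) \<phi> z)" if "\<phi> \<in> Emin" for c \<phi>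
    using that by (simp add: ST(3,5,7))
  fix t :: real assume "t > 0"
  obtain r C where rC: "r > 0" "\<And>\<phi>. \<phi> \<in> Emin \<Longrightarrow> exp_norm t (S \<phi>) \<le> C * exp_norm r \<phi>"
    using ST(4)[OF \<open>t > 0\<close>] by blast
  obtain r' C' where rC': "r' > 0" "\<And>\<phi>. \<phi> \<in> Emin \<Longrightarrow> exp_norm r (T \<phi>) \<le> C' * exp_norm r' \<phi>"
    using ST(8)[OF rC(1)] by blast
  have "exp_norm t ((S \<circ> T) \<phi>) \<le> \<bar>C\<bar> * C' * exp_norm r' \<phi>" if \<phi>: "\<phi> \<in> Emin" for \<phi>
  proof -
    have "exp_norm t (S (T \<phi>)) \<le> C * exp_norm r (T \<phi>)" by (rule rC(2)[OF ST(5)[OF \<phi>]])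
    also have "\<dots> \<le> \<bar>C\<bar> * exp_norm r (T \<phi>)"
      using exp_norm_nonneg[OF ST(5)[OF \<phi>] rC(1)] by (intro mult_right_mono) auto
    also have "\<dots> \<le> \<bar>C\<bar> * (C' * exp_norm r' \<phi>)" by (intro mult_left_mono rC'(2)[OF \<phi>]) simp
    finally show ?thesis by (simp add: mult.assoc)
  qed
  with rC'(1) show "\<exists>r>0. \<exists>C. \<forall>\<phi>\<in>Emin. exp_norm t ((S \<circ> T) \<phi>) \<le> C * exp_norm r \<phi>" by blast
qed

section \<open>Operators on polynomials\<close>

text \<open>A sequence with one monic member in each degree spans the polynomials, since subtracting
  a multiple of \<open>s n\<close> removes the coefficient of degree \<open>n\<close>.\<close>

lemma poly_monic_seq_induct [consumes 1, case_names add smult seq]: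
  fixes s :: "nat \<Rightarrow> complex poly"
  assumes s: "\<And>n. degree (s n) = n \<and> lead_coeff (s n) = 1"
    and add: "\<And>p q. Q p \<Longrightarrow> Q q \<Longrightarrow> Q (p + q)"
    and smult: "\<And>c p. Q p \<Longrightarrow> Q (smult c p)"
    and seq: "\<And>n. Q (s n)"
  shows "Q p"
proof -
  \<comment> \<open>Here \<open>n\<close> is a strict bound for the degree, so the base case is the
    zero polynomial, obtained as \<open>smult 0 (s 0)\<close>.\<close>
  have "Q p" if "\<And>i. i \<ge> n \<Longrightarrow> coeff p i = 0" for n p
    using that
  proof (induction n arbitrary: p)
    case 0
    then have "p = 0" by (intro poly_eqI) simp
    then show ?case using smult[OF seq[of 0], of 0] by simp
  next
    case (Suc n)
    have "coeff (p - smult (coeff p n) (s n)) i = 0" if "i \<ge> n" for i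
      using that Suc.prems[of i] s[of n] coeff_eq_0[of "s n" i] by (cases "i = n") auto
    then have "Q (p - smult (coeff p n) (s n))" by (rule Suc.IH)
    from add[OF this smult[OF seq[of n], of "coeff p n"]] show ?case by simp
  qed
  from this[of "Suc (degree p)" p] show ?thesis by (simp add: coeff_eq_0)
qed

lemma poly_linearD:
  fixes L :: "complex poly \<Rightarrow> complex poly"
  assumes "Vector_Spaces.linear smult smult L"
  shows "L (p + q) = L p + L q" and "L (smult c p) = smult c (L p)"
  using assms by (simp_all add: Vector_Spaces.linear_iff)

text \<open>A product rule with the left factor shifted by \<open>h\<close>; it is used to move
  multiplication by \<open>z\<close> past the difference operator.\<close>

lemma diff_op_mult_var:
  assumes "f \<in> Emin"
  shows "diff_op h (\<lambda>z. z * f z) z = (z + h) * diff_op h f z + f z"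
proof (cases "h = 0")
  case True
  have "f field_differentiable at z"
    using assms by (auto intro: holomorphic_on_imp_differentiable_at[of _ UNIV] Emin_holomorphic)
  then show ?thesis using True by (simp add: diff_op_def)
qed (simp add: diff_op_def field_simps)

section \<open>Operator identities from the recurrence\<close>

lemma recurrenceD:
  assumes "monic_recurrence_seq \<alpha> \<beta> \<sigma> s"
  shows "z * poly (s n) z = poly (s (Suc n)) z
    + ((\<alpha> + \<beta>) * of_nat n + shift_par \<alpha> \<beta> \<sigma>) * poly (s n) z
    + (of_real \<sigma> * of_nat n + \<alpha> * \<beta> * of_nat n * (of_nat n - 1)) * poly (s (n - 1)) z"
proof -
  have "poly ([:0, 1:] * s n) z = poly (s (Suc n)
        + smult ((\<alpha> + \<beta>) * of_nat n + shift_par \<alpha> \<beta> \<sigma>) (s n)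
        + smult (of_real \<sigma> * of_nat n + \<alpha> * \<beta> * of_nat n * (of_nat n - 1)) (s (n - 1))) z"
    using assms unfolding monic_recurrence_seq_def by metis
  then show ?thesis by simp
qed

lemma recurrence_Suc:
  assumes "monic_recurrence_seq \<alpha> \<beta> \<sigma> s"
  shows "s (Suc n) = [:0, 1:] * s n
    + smult (- ((\<alpha> + \<beta>) * of_nat n + shift_par \<alpha> \<beta> \<sigma>)) (s n)
    + smult (- (of_real \<sigma> * of_nat n + \<alpha> * \<beta> * of_nat n * (of_nat n - 1))) (s (n - 1))"
proof -
  have "[:0, 1:] * s n = s (Suc n)
        + smult ((\<alpha> + \<beta>) * of_nat n + shift_par \<alpha> \<beta> \<sigma>) (s n)
        + smult (of_real \<sigma> * of_nat n + \<alpha> * \<beta> * of_nat n * (of_nat n - 1)) (s (n - 1))"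
    using assms unfolding monic_recurrence_seq_def by metis
  then show ?thesis unfolding smult_minus_left by simp
qed

text \<open>In the commutator on \<open>s n\<close> the contributions of \<open>\<sigma>\<close> and
  \<open>shift_par\<close> cancel. What remains has the coefficients 1,
  \<open>(\<alpha> + \<beta>) * n\<close> and \<open>\<alpha> * \<beta> * n * (n - 1)\<close>, those
  of \<open>(1 + \<alpha> M) (1 + \<beta> M)\<close>.\<close>

lemma lowering_commutator:
  assumes rec: "monic_recurrence_seq \<alpha> \<beta> \<sigma> s" and M: "is_lowering_op s M"
  shows "M ([:0, 1:] * s n) = [:0, 1:] * M (s n) + V_poly \<alpha> M (V_poly \<beta> M (s n))"
proof -
  have lin: "Vector_Spaces.linear smult smult M" and Ms: "M (s k) = smult (of_nat k) (s (k - 1))" for k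
    using M by (simp_all add: is_lowering_op_def)
  note Madd = poly_linearD(1)[OF lin] and Msmult = poly_linearD(2)[OF lin]
  have xs: "[:0, 1:] * s n = s (Suc n)
        + smult ((\<alpha> + \<beta>) * of_nat n + shift_par \<alpha> \<beta> \<sigma>) (s n)
        + smult (of_real \<sigma> * of_nat n + \<alpha> * \<beta> * of_nat n * (of_nat n - 1)) (s (n - 1))"
    using rec unfolding monic_recurrence_seq_def by metis
  have "poly (M ([:0, 1:] * s n)) z
      = poly ([:0, 1:] * M (s n) + V_poly \<alpha> M (V_poly \<beta> M (s n))) z" for z
  proof (cases n)
    case 0
    then show ?thesis
      unfolding xs by (simp add: V_poly_def Madd Msmult Ms)
  next
    case (Suc m)
    \<comment> \<open>The recurrence one index below \<open>n\<close>, multiplied by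
      \<open>n\<close>, evaluates the term \<open>[:0, 1:] * M (s n)\<close>.\<close>
    have *: "z * (of_nat n * poly (s m) z) = of_nat n * (poly (s (Suc m)) z
      + ((\<alpha> + \<beta>) * of_nat m + shift_par \<alpha> \<beta> \<sigma>) * poly (s m) z
      + (of_real \<sigma> * of_nat m + \<alpha> * \<beta> * of_nat m * (of_nat m - 1)) * poly (s (m - 1)) z)"
      unfolding recurrenceD[OF rec, of z m, symmetric] by simp
    show ?thesis
      unfolding xs using * Suc by (simp add: V_poly_def Madd Msmult Ms algebra_simps)
  qed
  then show ?thesis by (simp add: poly_eq_poly_eq_iff[symmetric] fun_eq_iff)
qed

text \<open>Multiplied by \<open>\<alpha>\<close>, this states that \<open>1 - \<alpha> D_h\<close>
  is a left inverse of \<open>V\<close> on polynomials, where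
  \<open>h = \<beta> - \<alpha>\<close>.\<close>

lemma diff_op_V_poly:
  assumes rec: "monic_recurrence_seq \<alpha> \<beta> \<sigma> s" and M: "is_lowering_op s M"
  shows "diff_op (\<beta> - \<alpha>) (poly (V_poly \<alpha> M p)) z = poly (M p) z"
proof -
  have lin: "Vector_Spaces.linear smult smult M" and Ms: "M (s k) = smult (of_nat k) (s (k - 1))" for k
    using M by (simp_all add: is_lowering_op_def)
  have s: "degree (s n) = n \<and> lead_coeff (s n) = 1" "s 0 = 1" for n
    using rec unfolding monic_recurrence_seq_def by blast+
  note Madd = poly_linearD(1)[OF lin] and Msmult = poly_linearD(2)[OF lin]
  define h where "h = \<beta> - \<alpha>"
  define R where "R p z = diff_op h (poly (V_poly \<alpha> M p)) z - poly (M p) z" for p z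
  have pfun: "poly (p + q) = (\<lambda>z. poly p z + poly q z)" "poly (smult c p) = (\<lambda>z. c * poly p z)"
    "poly ([:0, 1:] * p) = (\<lambda>z. z * poly p z)" for p q :: "complex poly" and c
    by auto
  have Dadd: "diff_op h (poly (p + q)) z = diff_op h (poly p) z + diff_op h (poly q) z" for p q z
    unfolding pfun by (rule diff_op_add) (rule poly_in_Emin)+
  have Dsmult: "diff_op h (poly (smult c p)) z = c * diff_op h (poly p) z" for c p z
    unfolding pfun by (rule diff_op_cmult) (rule poly_in_Emin)
  have Dx: "diff_op h (poly ([:0, 1:] * p)) z = (z + h) * diff_op h (poly p) z + poly p z" for p z
    unfolding pfun by (rule diff_op_mult_var) (rule poly_in_Emin)
  have Vadd: "V_poly \<alpha> M (p + q) = V_poly \<alpha> M p + V_poly \<alpha> M q" for p q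
    by (simp add: V_poly_def Madd algebra_simps smult_add_right)
  have Vsmult: "V_poly \<alpha> M (smult c p) = smult c (V_poly \<alpha> M p)" for c p
    by (simp add: V_poly_def Msmult smult_add_right mult.commute)
  have Radd: "R (p + q) z = R p z + R q z" for p q z
    by (simp add: R_def Vadd Dadd Madd)
  have Rsmult: "R (smult c p) z = c * R p z" for c p z
    by (simp add: R_def Vsmult Dsmult Msmult right_diff_distrib)
  have Rx: "R ([:0, 1:] * s n) z = (z + h) * R (s n) z + \<alpha> * R (V_poly \<beta> M (s n)) z" for n z
  proof -
    let ?V' = "V_poly \<beta> M (s n)"
    have "V_poly \<alpha> M ([:0, 1:] * s n)
        = [:0, 1:] * V_poly \<alpha> M (s n) + smult \<alpha> (V_poly \<alpha> M ?V')"
      unfolding V_poly_def[of \<alpha> M "[:0, 1:] * s n"] lowering_commutator[OF rec M]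
      by (simp add: V_poly_def[of \<alpha> M "s n"] smult_add_right distrib_left mult_smult_right)
    then have "R ([:0, 1:] * s n) z = (z + h) * diff_op h (poly (V_poly \<alpha> M (s n))) z
        + poly (V_poly \<alpha> M (s n)) z + \<alpha> * diff_op h (poly (V_poly \<alpha> M ?V')) z
        - (z * poly (M (s n)) z + poly (V_poly \<alpha> M ?V') z)"
      by (simp only: R_def lowering_commutator[OF rec M] Dadd Dsmult Dx) simp
    moreover have "poly (V_poly \<alpha> M ?V') z = \<alpha> * poly (M ?V') z + poly ?V' z"
      by (simp add: V_poly_def[of \<alpha> M ?V'])
    \<comment> \<open>Here \<open>h = \<beta> - \<alpha>\<close> enters: the term
      \<open>h * M\<close> combines with \<open>z * M\<close> to produce the common factor
      \<open>z + h\<close> of \<open>R\<close>.\<close>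
    moreover have "poly (V_poly \<alpha> M (s n)) z = poly ?V' z - h * poly (M (s n)) z"
      by (simp add: V_poly_def h_def algebra_simps)
    ultimately show ?thesis by (simp add: R_def algebra_simps)
  qed
  have Rs: "R (s n) z = 0" for n z
  proof (induction n arbitrary: z rule: less_induct)
    case (less n)
    show ?case
    proof (cases n)
      case 0
      have "V_poly \<alpha> M (s 0) = [:1:]" using Ms[of 0] by (simp add: V_poly_def s(2) one_pCons)
      moreover have "diff_op h (poly [:1:]) z = 0"
        by (simp add: diff_op_def poly_pCons[abs_def])
      ultimately show ?thesis using 0 Ms[of 0] by (simp add: R_def)
    next
      case (Suc m)
      have m: "R (s m) z = 0" "R (s (m - 1)) z = 0" for z using less.IH Suc by auto
      \<comment> \<open>\<open>V_poly \<beta> M (s m)\<close> is a combination of \<open>s m\<close>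
        and \<open>s (m - 1)\<close>, both covered by the strong induction; for \<open>m = 0\<close>
        the second index is 0 again.\<close>
      have "R (V_poly \<beta> M (s m)) z = 0"
        by (simp add: V_poly_def Radd Rsmult Ms m[unfolded One_nat_def])
      then have "R ([:0, 1:] * s m) z = 0" by (simp only: Rx m) simp
      then show ?thesis unfolding Suc
        by (subst recurrence_Suc[OF rec]) (simp only: Radd Rsmult m, simp)
    qed
  qed
  have "R p z = 0"
    by (induction p rule: poly_monic_seq_induct[OF s(1)]) (simp_all add: Radd Rsmult Rs)
  then show ?thesis by (simp add: R_def h_def)
qed

text \<open>\<open>V\<close> is unitriangular in the basis \<open>s\<close>, so preimages are built
  recursively. Surjectivity turns a formula for \<open>U V\<close> into one for \<open>U\<close> on
  every polynomial.\<close>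

lemma surj_V_poly:
  assumes rec: "monic_recurrence_seq \<alpha> \<beta> \<sigma> s" and M: "is_lowering_op s M"
  obtains q where "V_poly \<alpha> M q = p"
proof -
  have lin: "Vector_Spaces.linear smult smult M" and Ms: "M (s k) = smult (of_nat k) (s (k - 1))" for k
    using M by (simp_all add: is_lowering_op_def)
  have s: "degree (s n) = n \<and> lead_coeff (s n) = 1" for n
    using rec unfolding monic_recurrence_seq_def by blast
  have Vadd: "V_poly \<alpha> M (p + q) = V_poly \<alpha> M p + V_poly \<alpha> M q" for p q
    by (simp add: V_poly_def poly_linearD[OF lin] algebra_simps smult_add_right)
  have Vsmult: "V_poly \<alpha> M (smult c p) = smult c (V_poly \<alpha> M p)" for c p
    by (simp add: V_poly_def poly_linearD[OF lin] smult_add_right mult.commute)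
  have "\<exists>q. V_poly \<alpha> M q = s n" for n
  proof (induction n)
    case 0
    then show ?case by (intro exI[of _ "s 0"]) (simp add: V_poly_def Ms)
  next
    case (Suc n)
    then obtain q where "V_poly \<alpha> M q = s n" by blast
    then have "V_poly \<alpha> M (s (Suc n) + smult (- (\<alpha> * of_nat (Suc n))) q) = s (Suc n)"
      unfolding Vadd Vsmult by (simp add: V_poly_def Ms)
    then show ?case by blast
  qed
  then have "\<exists>q. V_poly \<alpha> M q = p"
    by (induction p rule: poly_monic_seq_induct[OF s]) (metis Vadd, metis Vsmult)
  then show thesis using that by blast
qed

text \<open>On \<open>s n\<close> the product expands to the right side of the recurrence, except
  that \<open>\<sigma> / \<alpha>\<close> stands in place of \<open>shift_par\<close>; the
  difference is the constant coefficient on the right.\<close>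

lemma U_poly_V_poly:
  assumes rec: "monic_recurrence_seq \<alpha> \<beta> \<sigma> s" and P: "is_raising_op s P"
    and M: "is_lowering_op s M" and "\<alpha> \<noteq> 0"
  shows "U_poly \<alpha> \<beta> \<sigma> P M (V_poly \<alpha> M p) = [:of_real \<sigma> / \<alpha> - shift_par \<alpha> \<beta> \<sigma>, 1:] * p"
proof -
  have linM: "Vector_Spaces.linear smult smult M" and Ms: "M (s k) = smult (of_nat k) (s (k - 1))" for k
    using M by (simp_all add: is_lowering_op_def)
  have linP: "Vector_Spaces.linear smult smult P" and Ps: "P (s k) = s (Suc k)" for k
    using P by (simp_all add: is_raising_op_def)
  have s: "degree (s n) = n \<and> lead_coeff (s n) = 1" for n
    using rec unfolding monic_recurrence_seq_def by blast
  note L = poly_linearD[OF linM] poly_linearD[OF linP]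
  have P0: "P 0 = 0" using L(4)[of 0 0] by simp
  show ?thesis
  proof (induction p rule: poly_monic_seq_induct[OF s])
    case (1 p q)
    have "U_poly \<alpha> \<beta> \<sigma> P M (V_poly \<alpha> M (p + q))
        = U_poly \<alpha> \<beta> \<sigma> P M (V_poly \<alpha> M p) + U_poly \<alpha> \<beta> \<sigma> P M (V_poly \<alpha> M q)"
      by (simp add: U_poly_def V_poly_def L smult_add_right)
    with 1 show ?case by (simp only: distrib_left)
  next
    case (2 c p)
    have "U_poly \<alpha> \<beta> \<sigma> P M (V_poly \<alpha> M (smult c p)) = smult c (U_poly \<alpha> \<beta> \<sigma> P M (V_poly \<alpha> M p))"
      by (simp add: U_poly_def V_poly_def L smult_add_right ac_simps)
    with 2 show ?case by (simp only: mult_smult_right)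
  next
    case (3 n)
    have "poly (U_poly \<alpha> \<beta> \<sigma> P M (V_poly \<alpha> M (s n))) z
        = poly ([:of_real \<sigma> / \<alpha> - shift_par \<alpha> \<beta> \<sigma>, 1:] * s n) z" for z
    proof (cases n)
      case 0
      then show ?thesis using recurrenceD[OF rec, of z n]
        by (simp add: U_poly_def V_poly_def L Ms Ps P0 algebra_simps)
    next
      case (Suc m)
      \<comment> \<open>For \<open>m = 0\<close> the term \<open>M (s m)\<close> vanishes; otherwise
        \<open>P\<close> raises it back to a multiple of \<open>s m\<close>. Division by
        \<open>\<alpha>\<close> cancels in the term
        \<open>\<sigma> / \<alpha> * \<alpha> * n\<close>.\<close>
      then show ?thesis using recurrenceD[OF rec, of z n] assms(4)
        by (cases m) (simp_all add: U_poly_def V_poly_def L Ms Ps field_simps)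
    qed
    then show ?case by (simp add: poly_eq_poly_eq_iff[symmetric] fun_eq_iff)
  qed
qed

section \<open>Extensions of \<open>U\<close> and \<open>V\<close> and their factorisations\<close>

theorem proposition3p12:
  fixes \<alpha> \<beta> :: complex and \<sigma> :: real
    and s :: "nat \<Rightarrow> complex poly"
    and P M :: "complex poly \<Rightarrow> complex poly"
  assumes "\<sigma> > 0"
    and "real_case \<alpha> \<beta> \<or> conj_case \<alpha> \<beta>"
    and "monic_recurrence_seq \<alpha> \<beta> \<sigma> s"
    and "is_raising_op s P"
    and "is_lowering_op s M"
  shows "continuous_linear_op mult_var_op \<and>
    (\<exists>U V.
      continuous_linear_extension (U_poly \<alpha> \<beta> \<sigma> P M) U \<and>
      (\<forall>U'. continuous_linear_extension (U_poly \<alpha> \<beta> \<sigma> P M) U' \<longrightarrow> (\<forall>\<phi>\<in>Emin. U' \<phi> = U \<phi>)) \<and>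
      continuous_linear_extension (V_poly \<alpha> M) V \<and>
      (\<forall>V'. continuous_linear_extension (V_poly \<alpha> M) V' \<longrightarrow> (\<forall>\<phi>\<in>Emin. V' \<phi> = V \<phi>)) \<and>
      (real_case \<alpha> \<beta> \<longrightarrow>
        (\<forall>\<phi>\<in>Emin. mult_var_op \<phi> = U (V \<phi>)) \<and>
        (\<forall>\<phi>\<in>Emin. U \<phi> = mult_var_op (one_minus_diff_op \<alpha> \<beta> \<phi>))) \<and>
      (conj_case \<alpha> \<beta> \<longrightarrow>
        (\<forall>\<phi>\<in>Emin. (\<lambda>z. mult_var_op \<phi> z + of_real \<sigma> / \<alpha> * \<phi> z) = U (V \<phi>)) \<and>
        (\<forall>\<phi>\<in>Emin. U \<phi> =
          (\<lambda>z. mult_var_op (one_minus_diff_op \<alpha> \<beta> \<phi>) z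
             + of_real \<sigma> / \<alpha> * one_minus_diff_op \<alpha> \<beta> \<phi> z))) \<and>
      homeomorphic_map Emin_topology Emin_topology (one_minus_diff_op \<alpha> \<beta>) \<and>
      (\<forall>\<phi>\<in>Emin. V \<phi> = inv_into Emin (one_minus_diff_op \<alpha> \<beta>) \<phi>))"
proof -
  \<comment> \<open>This constant treats both cases at once: it is 0 for real parameters and
    \<open>\<sigma> / \<alpha>\<close> for conjugate ones.\<close>
  define c where "c = of_real \<sigma> / \<alpha> - shift_par \<alpha> \<beta> \<sigma>"
  define A where "A = (\<lambda>\<phi> z. \<alpha> * diff_op (\<beta> - \<alpha>) \<phi> z)"
  let ?W = "one_minus_diff_op \<alpha> \<beta>"
  have W: "?W = (\<lambda>\<phi> z. \<phi> z - A \<phi> z)" by (simp add: one_minus_diff_op_def A_def fun_eq_iff)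
  have "\<alpha> \<noteq> 0" using assms(2) by (auto simp: real_case_def conj_case_def)
  have A: "bounded_linear_Emin A" unfolding A_def by (rule bounded_linear_diff_op)
  obtain t0 where "t0 > 0"
    and "\<And>t \<phi>. 0 < t \<Longrightarrow> t \<le> t0 \<Longrightarrow> \<phi> \<in> Emin \<Longrightarrow> exp_norm t (A \<phi>) \<le> exp_norm t \<phi> / 2"
    unfolding A_def using diff_op_small[of \<alpha> "\<beta> - \<alpha>"] by blast
  then obtain V where V: "bounded_linear_Emin V"
    and VW: "\<And>\<phi>. \<phi> \<in> Emin \<Longrightarrow> V (?W \<phi>) = \<phi>"
    and WV: "\<And>\<phi>. \<phi> \<in> Emin \<Longrightarrow> ?W (V \<phi>) = \<phi>"
    using Neumann_inverse[OF A] unfolding W by blast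
  have W_bl: "bounded_linear_Emin ?W" unfolding W by (rule bounded_linear_id_minus[OF A])
  \<comment> \<open>The factorisation is taken as the definition, so what remains to be shown is
    that it extends \<open>U_poly\<close>.\<close>
  define U where "U = (\<lambda>\<phi> z. (z + c) * ?W \<phi> z)"
  have U_bl: "bounded_linear_Emin U"
    using bounded_linear_Emin_compose[OF bounded_linear_mult_affine[of c] W_bl]
    by (simp add: U_def o_def)
  have W_poly: "?W (poly (V_poly \<alpha> M p)) = poly p" for p
    using diff_op_V_poly[OF assms(3,5), of p]
    by (simp add: one_minus_diff_op_def fun_eq_iff V_poly_def)
  \<comment> \<open>Applying \<open>V\<close> to both sides of \<open>W_poly\<close> identifies its
    values on polynomials.\<close>
  have V_ext: "continuous_linear_extension (V_poly \<alpha> M) V"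
    using bounded_linear_imp_continuous_linear_op[OF V] VW[OF poly_in_Emin] W_poly
    unfolding continuous_linear_extension_def by metis
  have "U (poly p) = poly (U_poly \<alpha> \<beta> \<sigma> P M p)" for p
  proof -
    \<comment> \<open>Writing \<open>p\<close> as \<open>V_poly \<alpha> M q\<close> reduces the
      claim to \<open>W_poly\<close> and the formula for the product of \<open>U_poly\<close> and
      \<open>V_poly\<close>.\<close>
    obtain q where "V_poly \<alpha> M q = p" using surj_V_poly[OF assms(3,5)] .
    then show ?thesis
      using W_poly[of q] U_poly_V_poly[OF assms(3,4,5) \<open>\<alpha> \<noteq> 0\<close>, of q]
      by (auto simp: U_def c_def fun_eq_iff algebra_simps)
  qed
  then have U_ext: "continuous_linear_extension (U_poly \<alpha> \<beta> \<sigma> P M) U"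
    using bounded_linear_imp_continuous_linear_op[OF U_bl]
    by (simp add: continuous_linear_extension_def)
  have c: "real_case \<alpha> \<beta> \<Longrightarrow> c = 0" "conj_case \<alpha> \<beta> \<Longrightarrow> c = of_real \<sigma> / \<alpha>"
    by (auto simp: c_def shift_par_def real_case_def conj_case_def complex_is_Real_iff)
  have inv: "V \<phi> = inv_into Emin ?W \<phi>" if "\<phi> \<in> Emin" for \<phi>
  proof -
    \<comment> \<open>Injectivity makes the choice in \<open>inv_into\<close> unique, so it returns
      the known preimage \<open>V \<phi>\<close>.\<close>
    have "inj_on ?W Emin" by (metis VW inj_onI)
    from inv_into_f_f[OF this bounded_linear_EminD(1)[OF V that]] show ?thesis
      by (simp add: WV[OF that])
  qed
  have "homeomorphic_maps Emin_topology Emin_topology ?W V"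
    using bounded_linear_imp_continuous_linear_op[OF V] bounded_linear_imp_continuous_linear_op[OF W_bl]
    by (simp add: homeomorphic_maps_def continuous_linear_op_def topspace_Emin_topology VW WV)
  then have hom: "homeomorphic_map Emin_topology Emin_topology ?W"
    by (rule homeomorphic_maps_imp_map)
  have Z: "continuous_linear_op mult_var_op"
    using bounded_linear_imp_continuous_linear_op[OF bounded_linear_mult_affine[of 0]]
    by (simp add: mult_var_op_def[abs_def])
  show ?thesis
  proof (rule conjI[OF Z], rule exI[of _ U], rule exI[of _ V], intro conjI)
    show "\<forall>U'. continuous_linear_extension (U_poly \<alpha> \<beta> \<sigma> P M) U' \<longrightarrow> (\<forall>\<phi>\<in>Emin. U' \<phi> = U \<phi>)"
      using continuous_linear_extension_unique U_ext by blast
    show "\<forall>V'. continuous_linear_extension (V_poly \<alpha> M) V' \<longrightarrow> (\<forall>\<phi>\<in>Emin. V' \<phi> = V \<phi>)"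
      using continuous_linear_extension_unique V_ext by blast
    show "real_case \<alpha> \<beta> \<longrightarrow> (\<forall>\<phi>\<in>Emin. mult_var_op \<phi> = U (V \<phi>)) \<and>
        (\<forall>\<phi>\<in>Emin. U \<phi> = mult_var_op (?W \<phi>))"
      by (simp add: U_def mult_var_op_def c(1) WV)
    show "conj_case \<alpha> \<beta> \<longrightarrow>
        (\<forall>\<phi>\<in>Emin. (\<lambda>z. mult_var_op \<phi> z + of_real \<sigma> / \<alpha> * \<phi> z) = U (V \<phi>)) \<and>
        (\<forall>\<phi>\<in>Emin. U \<phi> = (\<lambda>z. mult_var_op (?W \<phi>) z + of_real \<sigma> / \<alpha> * ?W \<phi> z))"
      by (simp add: U_def mult_var_op_def c(2) WV distrib_right)
  qed (use U_ext V_ext hom inv in blast)+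
qed

end
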